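(* Let $(f_1,g_1)$ and $(f_2,g_2)$ be invertible pairs in $A_{\mathbb{R}}(\mathbb{D})^2$. Then $(f_1,g_1)$ and $(f_2,g_2)$ are simultaneously stabilizable, i.e. there exist $\alpha,\beta\in A_{\mathbb{R}}(\mathbb{D})$ such that $\alpha f_j+\beta g_j\in A_{\mathbb{R}}(\mathbb{D})^{-1}$ for $j=1,2$, if and only if they are sign-linked.
   Context: $\mathbb{D}$ is the open unit disc in $\mathbb{C}$. The disc algebra $A(\mathbb{D})$ is the algebra of functions continuous on $\overline{\mathbb{D}}$ and holomorphic in $\mathbb{D}$. $A_{\mathbb{R}}(\mathbb{D})$ is the real algebra of all $f\in A(\mathbb{D})$ with $f(z)=\overline{f(\overline{z})}$ for all $z\in\overline{\mathbb{D}}$, and $A_{\mathbb{R}}(\mathbb{D})^{-1}$ is its set of invertible elements. Functions in $A_{\mathbb{R}}(\mathbb{D})$ are real-valued on $[-1,1]$. A pair $(f,g)\in A_{\mathbb{R}}(\mathbb{D})^2$ is invertible if there exist $\alpha,\beta\in A_{\mathbb{R}}(\mathbb{D})$ with $\alpha f+\beta g=1$; the set of invertible pairs is denoted $U_2(A_{\mathbb{R}}(\mathbb{D}))$. Two invertible pairs $(f_1,g_1)$, $(f_2,g_2)$ are called sign-linked if the following holds. Let $S$ be the set of $x\in[-1,1]$ at which the matrix $\begin{pmatrix} f_1(x)& g_1(x)\\ f_2(x)&g_2(x)\end{pmatrix}$ is singular. For each $x\in S$ there is a unique real number $\lambda(x)$ with $(f_2(x),g_2(x))=\lambda(x)\,(f_1(x),g_1(x))$,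 and $\lambda(x)\ne 0$. The requirement is that $\lambda$ has constant sign on $S$: either $\lambda(x)>0$ for all $x\in S$, or $\lambda(x)<0$ for all $x\in S$ (vacuously satisfied if $S=\emptyset$). *)

theory Defs
  imports "HOL-Analysis.Analysis"
begin

text \<open>
  Elements of the disc algebra are represented by total functions whose values outside the
  closed unit disc are irrelevant: membership constrains a function on \<^term>\<open>cball 0 1\<close> only, and
  identities between elements are accordingly required on \<^term>\<open>cball 0 1\<close> only.
\<close>

definition disc_algebra :: "(complex \<Rightarrow> complex) set" where
  "disc_algebra = {f. continuous_on (cball 0 1) f \<and> f holomorphic_on ball 0 1}"

definition real_disc_algebra :: "(complex \<Rightarrow> complex) set" where
  "real_disc_algebra = {f \<in> disc_algebra. \<forall>z\<in>cball 0 1. f z = cnj (f (cnj z))}"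

definition real_disc_algebra_units :: "(complex \<Rightarrow> complex) set" where
  "real_disc_algebra_units =
     {f \<in> real_disc_algebra. \<exists>h\<in>real_disc_algebra. \<forall>z\<in>cball 0 1. f z * h z = 1}"

definition invertible_pairs :: "((complex \<Rightarrow> complex) \<times> (complex \<Rightarrow> complex)) set" where
  "invertible_pairs = {(f, g). f \<in> real_disc_algebra \<and> g \<in> real_disc_algebra \<and>
     (\<exists>\<alpha>\<in>real_disc_algebra. \<exists>\<beta>\<in>real_disc_algebra. \<forall>z\<in>cball 0 1. \<alpha> z * f z + \<beta> z * g z = 1)}"

definition pair_matrix ::
  "(complex \<Rightarrow> complex) \<times> (complex \<Rightarrow> complex) \<Rightarrow> (complex \<Rightarrow> complex) \<times> (complex \<Rightarrow> complex)
    \<Rightarrow> real \<Rightarrow> complex^2^2" where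
  "pair_matrix p q x =
     vector [vector [fst p (of_real x), snd p (of_real x)],
             vector [fst q (of_real x), snd q (of_real x)]]"

definition singular_points ::
  "(complex \<Rightarrow> complex) \<times> (complex \<Rightarrow> complex) \<Rightarrow> (complex \<Rightarrow> complex) \<times> (complex \<Rightarrow> complex)
    \<Rightarrow> real set" where
  "singular_points p q = {x \<in> {-1..1}. \<not> invertible (pair_matrix p q x)}"

text \<open>
  For invertible pairs and a singular point, the description below denotes: see
  \<open>pair_ratio_ex1\<close> and \<open>pair_ratio_nonzero\<close>.
\<close>

definition pair_ratio ::
  "(complex \<Rightarrow> complex) \<times> (complex \<Rightarrow> complex) \<Rightarrow> (complex \<Rightarrow> complex) \<times> (complex \<Rightarrow> complex)
    \<Rightarrow> real \<Rightarrow> real" where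
  "pair_ratio p q x =
     (THE r::real. fst q (of_real x) = of_real r * fst p (of_real x) \<and>
                   snd q (of_real x) = of_real r * snd p (of_real x))"

definition sign_linked ::
  "(complex \<Rightarrow> complex) \<times> (complex \<Rightarrow> complex) \<Rightarrow> (complex \<Rightarrow> complex) \<times> (complex \<Rightarrow> complex)
    \<Rightarrow> bool" where
  "sign_linked p q \<longleftrightarrow>
     (\<forall>x\<in>singular_points p q. pair_ratio p q x > 0) \<or>
     (\<forall>x\<in>singular_points p q. pair_ratio p q x < 0)"

lemma real_disc_algebra_real_on_interval:
  assumes "f \<in> real_disc_algebra" "x \<in> {-1..1}"
  obtains r where "f (of_real x) = of_real r"
proof -
  have "f (of_real x) = cnj (f (of_real x))"
    using assms by (auto simp: real_disc_algebra_def dest!: bspec[of _ _ "of_real x"])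
  then have "f (of_real x) \<in> \<real>"
    by (simp add: Reals_cnj_iff)
  then show thesis
    using that by (auto elim: Reals_cases)
qed

lemma invertible_pairs_nonzero:
  assumes "p \<in> invertible_pairs" "x \<in> {-1..1}"
  shows "fst p (of_real x) \<noteq> 0 \<or> snd p (of_real x) \<noteq> 0"
proof -
  obtain a b where "\<forall>z\<in>cball 0 1. a z * fst p z + b z * snd p z = (1::complex)"
    using assms(1) by (auto simp: invertible_pairs_def)
  then have "a (of_real x) * fst p (of_real x) + b (of_real x) * snd p (of_real x) = 1"
    using assms(2) by (auto dest!: bspec[of _ _ "of_real x"])
  then show ?thesis by auto
qed

lemma pair_ratio_ex1:
  assumes p: "p \<in> invertible_pairs" and q: "q \<in> invertible_pairs"
    and x: "x \<in> singular_points p q"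
  shows "\<exists>!r::real. fst q (of_real x) = of_real r * fst p (of_real x) \<and>
                    snd q (of_real x) = of_real r * snd p (of_real x)"
proof -
  have xI: "x \<in> {-1..1}" using x by (simp add: singular_points_def)
  have mem: "fst p \<in> real_disc_algebra" "snd p \<in> real_disc_algebra"
       "fst q \<in> real_disc_algebra" "snd q \<in> real_disc_algebra"
    using p q by (auto simp: invertible_pairs_def)
  obtain a where a: "fst p (of_real x) = of_real a"
    using real_disc_algebra_real_on_interval[OF mem(1) xI] .
  obtain b where b: "snd p (of_real x) = of_real b"
    using real_disc_algebra_real_on_interval[OF mem(2) xI] .
  obtain c where c: "fst q (of_real x) = of_real c"
    using real_disc_algebra_real_on_interval[OF mem(3) xI] .
  obtain d where d: "snd q (of_real x) = of_real d"
    using real_disc_algebra_real_on_interval[OF mem(4) xI] .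
  have "complex_of_real (a * d) = complex_of_real (b * c)"
    using x by (simp add: singular_points_def invertible_det_nz pair_matrix_def det_2 a b c d)
  then have det: "a * d = b * c"
    by (simp only: of_real_eq_iff)
  have nz: "a \<noteq> 0 \<or> b \<noteq> 0"
    using invertible_pairs_nonzero[OF p xI] a b by auto
  have "\<exists>!r. c = r * a \<and> d = r * b"
  proof (cases "a = 0")
    case True
    with nz det show ?thesis by (intro ex1I[of _ "d / b"]) auto
  next
    case False
    with det show ?thesis by (intro ex1I[of _ "c / a"]) (auto simp: field_simps)
  qed
  then show ?thesis
    by (simp add: a b c d flip: of_real_mult)
qed

lemma pair_ratio_nonzero:
  assumes p: "p \<in> invertible_pairs" and q: "q \<in> invertible_pairs"
    and x: "x \<in> singular_points p q"
  shows "pair_ratio p q x \<noteq> 0"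
proof
  assume 0: "pair_ratio p q x = 0"
  have "fst q (of_real x) = of_real (pair_ratio p q x) * fst p (of_real x) \<and>
        snd q (of_real x) = of_real (pair_ratio p q x) * snd p (of_real x)"
    unfolding pair_ratio_def by (rule theI') (rule pair_ratio_ex1[OF assms])
  moreover have "x \<in> {-1..1}" using x by (simp add: singular_points_def)
  ultimately show False
    using 0 invertible_pairs_nonzero[OF q] by auto
qed

end

theory Submission
  imports Defs "HOL-Complex_Analysis.Complex_Analysis"
    "HOL-Computational_Algebra.Fundamental_Theorem_Algebra"
begin

text \<open>
  Only the values on \<open>[-1,1]\<close> obstruct simultaneous stabilization. If \<open>u = \<alpha> f\<^sub>1 + \<beta> g\<^sub>1\<close> and
  \<open>v = \<alpha> f\<^sub>2 + \<beta> g\<^sub>2\<close> are units, both are real without zeros on \<open>[-1,1]\<close>, so \<open>u v\<close> has one sign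
  there; at a singular point \<open>v = \<lambda> u\<close>, so \<open>\<lambda>\<close> has that sign.

  For the converse take \<open>a\<^sub>1 f\<^sub>1 + b\<^sub>1 g\<^sub>1 = 1\<close>. The matrix with columns \<open>(a\<^sub>1, b\<^sub>1)\<close> and
  \<open>(-g\<^sub>1, f\<^sub>1)\<close> has determinant 1 and carries the two pairs to \<open>(1, 0)\<close> and \<open>(f, g)\<close> with
  \<open>f = a\<^sub>1 f\<^sub>2 + b\<^sub>1 g\<^sub>2\<close> and \<open>g = f\<^sub>1 g\<^sub>2 - g\<^sub>1 f\<^sub>2\<close>. The zeros of \<open>g\<close> in \<open>[-1,1]\<close> are the singular
  points, and \<open>f = \<lambda>\<close> there. It remains to write \<open>f = u + k g\<close> with a unit \<open>u\<close>, that is, to lift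
  the class of \<open>f\<close> modulo \<open>g\<close> to a unit, knowing that \<open>f\<close> has one sign on the real zeros of \<open>g\<close>;
  replacing \<open>f\<close> by \<open>-f\<close>, this sign is positive (\<open>congruent_to_unit_if_positive\<close>).

  Two observations carry this step. Liftable functions are closed under products; and, for fixed
  \<open>g\<close>, liftability is locally constant among the functions comaximal with \<open>g\<close>, hence
  constant along connected families of them (\<open>congruent_to_unit_connected_family\<close>). By the
  second one, \<open>f\<close> may be replaced by a nearby polynomial with real coefficients; by the first one,
  this polynomial may be treated factor by factor.
  Its roots avoid the zero set \<open>Z\<close> of \<open>g\<close> in the closed disc, and a root may be moved as long as
  it stays off \<open>Z\<close>. The complement of \<open>Z\<close> in the plane is connected
  (\<open>connected_complement_zeros\<close>), so a pair of conjugate roots can be moved out of the closed disc,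
  where its quadratic factor becomes a unit. A real root with no zeros of \<open>g\<close> on one side of it is
  moved out of the disc along the real axis on that side. Any other real root lies in a gap between
  two zeros of \<open>g\<close>, and positivity at the two ends forces a second root in this gap, counted with
  multiplicity. The two can be brought together, and a double real root is a degenerate conjugate
  pair. So real roots are removed two at a time in every inner gap
  (\<open>congruent_to_unit_poly\<close>).
\<close>
section \<open>The disc algebra and its real form\<close>

lemma disc_algebra_const: "(\<lambda>z. c) \<in> disc_algebra"
  and disc_algebra_id: "(\<lambda>z. z) \<in> disc_algebra"
  and disc_algebra_add: "\<lbrakk>f \<in> disc_algebra; g \<in> disc_algebra\<rbrakk> \<Longrightarrow> (\<lambda>z. f z + g z) \<in> disc_algebra"
  and disc_algebra_diff: "\<lbrakk>f \<in> disc_algebra; g \<in> disc_algebra\<rbrakk> \<Longrightarrow> (\<lambda>z. f z - g z) \<in> disc_algebra"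
  and disc_algebra_mult: "\<lbrakk>f \<in> disc_algebra; g \<in> disc_algebra\<rbrakk> \<Longrightarrow> (\<lambda>z. f z * g z) \<in> disc_algebra"
  and disc_algebra_poly: "(\<lambda>z. poly p z) \<in> disc_algebra"
  and disc_algebra_uminus: "f \<in> disc_algebra \<Longrightarrow> (\<lambda>z. - f z) \<in> disc_algebra"
  by (auto simp: disc_algebra_def intro!: continuous_intros holomorphic_intros)

lemma disc_algebra_inverse:
  assumes "f \<in> disc_algebra" "\<And>z. z \<in> cball 0 1 \<Longrightarrow> f z \<noteq> 0"
  shows "(\<lambda>z. inverse (f z)) \<in> disc_algebra"
  using assms by (auto simp: disc_algebra_def intro!: continuous_intros holomorphic_intros)

lemma disc_algebra_cnj:
  assumes "f \<in> disc_algebra"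
  shows "(\<lambda>z. cnj (f (cnj z))) \<in> disc_algebra"
proof -
  have "continuous_on (cball 0 1) (\<lambda>z. cnj (f (cnj z)))"
    using assms
    by (auto simp: disc_algebra_def intro!: continuous_intros continuous_on_compose2[of "cball 0 1" f])
  moreover have "(cnj \<circ> f \<circ> cnj) holomorphic_on ball 0 1"
    using assms by (subst holomorphic_on_compose_cnj_cnj)
      (auto simp: disc_algebra_def image_iff intro: holomorphic_on_subset)
  ultimately show ?thesis
    by (simp add: disc_algebra_def o_def)
qed

lemma real_disc_algebra_iff:
  "f \<in> real_disc_algebra \<longleftrightarrow>
     f \<in> disc_algebra \<and> (\<forall>z\<in>cball 0 1. f (cnj z) = cnj (f z))"
proof -
  have "f z = cnj (f (cnj z)) \<longleftrightarrow> f (cnj z) = cnj (f z)" for z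
    using complex_cnj_cancel_iff[of "f z" "cnj (f (cnj z))"]
    unfolding complex_cnj_cnj by (simp only: eq_commute[of "cnj (f z)"])
  then show ?thesis
    unfolding real_disc_algebra_def mem_Collect_eq by (simp only:)
qed

lemma real_disc_algebraD:
  assumes "f \<in> real_disc_algebra"
  shows "f \<in> disc_algebra" and "z \<in> cball 0 1 \<Longrightarrow> f (cnj z) = cnj (f z)"
  using assms unfolding real_disc_algebra_iff by blast+

lemma real_disc_algebraI:
  assumes "f \<in> disc_algebra" "\<And>z. z \<in> cball 0 1 \<Longrightarrow> f (cnj z) = cnj (f z)"
  shows "f \<in> real_disc_algebra"
  using assms unfolding real_disc_algebra_iff by blast

lemma real_disc_algebra_of_real: "(\<lambda>z. of_real c) \<in> real_disc_algebra"
  and real_disc_algebra_1: "(\<lambda>z. 1) \<in> real_disc_algebra"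
  and real_disc_algebra_0: "(\<lambda>z. 0) \<in> real_disc_algebra"
  and real_disc_algebra_id: "(\<lambda>z. z) \<in> real_disc_algebra"
  by (auto intro!: real_disc_algebraI disc_algebra_const disc_algebra_id)

context
  fixes f g :: "complex \<Rightarrow> complex"
  assumes f: "f \<in> real_disc_algebra"
begin

lemma real_disc_algebra_uminus: "(\<lambda>z. - f z) \<in> real_disc_algebra"
  by (rule real_disc_algebraI) (simp_all add: real_disc_algebraD[OF f] disc_algebra_uminus)

lemma real_disc_algebra_inverse:
  assumes "\<And>z. z \<in> cball 0 1 \<Longrightarrow> f z \<noteq> 0"
  shows "(\<lambda>z. inverse (f z)) \<in> real_disc_algebra"
  using assms by (intro real_disc_algebraI disc_algebra_inverse) (simp_all add: real_disc_algebraD[OF f])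

context
  assumes g: "g \<in> real_disc_algebra"
begin

lemma real_disc_algebra_add: "(\<lambda>z. f z + g z) \<in> real_disc_algebra"
  and real_disc_algebra_diff: "(\<lambda>z. f z - g z) \<in> real_disc_algebra"
  and real_disc_algebra_mult: "(\<lambda>z. f z * g z) \<in> real_disc_algebra"
  by (rule real_disc_algebraI, simp_all add: real_disc_algebraD[OF f] real_disc_algebraD[OF g]
      disc_algebra_add disc_algebra_diff disc_algebra_mult)+

end

end

lemmas real_disc_algebra_intros =
  real_disc_algebra_of_real real_disc_algebra_1 real_disc_algebra_0 real_disc_algebra_id
  real_disc_algebra_add real_disc_algebra_diff real_disc_algebra_mult real_disc_algebra_uminus
  real_disc_algebra_inverse

lemma real_disc_algebra_units_iff:
  "f \<in> real_disc_algebra_units \<longleftrightarrow> f \<in> real_disc_algebra \<and> (\<forall>z\<in>cball 0 1. f z \<noteq> 0)"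
proof
  assume R: "f \<in> real_disc_algebra \<and> (\<forall>z\<in>cball 0 1. f z \<noteq> 0)"
  then have "(\<lambda>z. inverse (f z)) \<in> real_disc_algebra"
    by (intro real_disc_algebra_inverse) auto
  moreover have "\<forall>z\<in>cball 0 1. f z * inverse (f z) = 1"
    using R by auto
  ultimately show "f \<in> real_disc_algebra_units"
    using R unfolding real_disc_algebra_units_def by (intro CollectI conjI bexI) auto
next
  assume "f \<in> real_disc_algebra_units"
  then show "f \<in> real_disc_algebra \<and> (\<forall>z\<in>cball 0 1. f z \<noteq> 0)"
    unfolding real_disc_algebra_units_def by force
qed

lemma disc_algebra_bounded:
  assumes "f \<in> disc_algebra"
  obtains B where "B > 0" "\<And>z. z \<in> cball 0 1 \<Longrightarrow> norm (f z) \<le> B"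
proof -
  have "compact (f ` cball 0 1)"
    using assms by (intro compact_continuous_image) (auto simp: disc_algebra_def)
  then have "bounded (f ` cball 0 1)"
    by (rule compact_imp_bounded)
  then show thesis
    using that by (auto simp: bounded_pos)
qed

lemma disc_algebra_continuous_on_interval:
  assumes "f \<in> disc_algebra"
  shows "continuous_on {-1..1} (\<lambda>x. f (complex_of_real x))"
proof (rule continuous_on_compose2[of "cball 0 1" f])
  show "continuous_on (cball 0 1) f" using assms by (simp add: disc_algebra_def)
  show "continuous_on {-1..1} complex_of_real" by (intro continuous_intros)
  show "complex_of_real ` {-1..1} \<subseteq> cball 0 1" by auto
qed

section \<open>Comaximal pairs\<close>

text \<open>The coefficients are taken from the complex disc algebra, which contains the linear factors
  with nonreal roots.\<close>
definition disc_comaximal :: "(complex \<Rightarrow> complex) \<Rightarrow> (complex \<Rightarrow> complex) \<Rightarrow> bool" where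
  "disc_comaximal g f \<longleftrightarrow>
     (\<exists>\<alpha>\<in>disc_algebra. \<exists>\<beta>\<in>disc_algebra. \<forall>z\<in>cball 0 1. \<alpha> z * f z + \<beta> z * g z = 1)"

lemma invertible_pairsI:
  assumes "f \<in> real_disc_algebra" "g \<in> real_disc_algebra"
    "a \<in> real_disc_algebra" "b \<in> real_disc_algebra"
    and "\<And>z. z \<in> cball 0 1 \<Longrightarrow> a z * f z + b z * g z = 1"
  shows "(f, g) \<in> invertible_pairs"
  using assms unfolding invertible_pairs_def by blast

text \<open>Reflecting the coefficients of a Bezout identity, \<open>h(z) \<mapsto> cnj (h (cnj z))\<close>, gives another
  Bezout identity for the same real functions, and the average of the two has real coefficients.\<close>
lemma disc_comaximal_imp_invertible_pair:
  assumes f: "f \<in> real_disc_algebra" and g: "g \<in> real_disc_algebra" and "disc_comaximal g f"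
  shows "(f, g) \<in> invertible_pairs"
proof -
  obtain a b where ab: "a \<in> disc_algebra" "b \<in> disc_algebra"
    and eq: "\<And>z. z \<in> cball 0 1 \<Longrightarrow> a z * f z + b z * g z = 1"
    using assms unfolding disc_comaximal_def by blast
  define S where "S = (\<lambda>h::complex \<Rightarrow> complex. \<lambda>z. (1/2) * (h z + cnj (h (cnj z))))"
  have S: "S h \<in> real_disc_algebra" if "h \<in> disc_algebra" for h
    unfolding S_def
    by (intro real_disc_algebraI disc_algebra_mult disc_algebra_const disc_algebra_add
        disc_algebra_cnj that) (simp add: add.commute)
  have "S a z * f z + S b z * g z = 1" if z: "z \<in> cball 0 1" for z
  proof -
    have "cnj (a (cnj z)) * f z + cnj (b (cnj z)) * g z
        = cnj (a (cnj z) * f (cnj z) + b (cnj z) * g (cnj z))"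
      using real_disc_algebraD(2)[OF f z] real_disc_algebraD(2)[OF g z] by simp
    also have "\<dots> = 1" using eq[of "cnj z"] z by simp
    finally have 2: "cnj (a (cnj z)) * f z + cnj (b (cnj z)) * g z = 1" .
    have "S a z * f z + S b z * g z
        = (1/2) * ((a z * f z + b z * g z) + (cnj (a (cnj z)) * f z + cnj (b (cnj z)) * g z))"
      by (simp add: S_def algebra_simps)
    then show ?thesis using 2 eq[OF z] by simp
  qed
  then show ?thesis
    by (rule invertible_pairsI[OF f g S[OF ab(1)] S[OF ab(2)]])
qed

lemma disc_comaximal_mult:
  assumes "disc_comaximal g p" "disc_comaximal g q" "p \<in> disc_algebra"
  shows "disc_comaximal g (\<lambda>z. p z * q z)"
proof -
  obtain a b c d where ab: "a \<in> disc_algebra" "b \<in> disc_algebra" "c \<in> disc_algebra" "d \<in> disc_algebra"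
    and eq: "\<And>z. z \<in> cball 0 1 \<Longrightarrow> a z * p z + b z * g z = 1"
            "\<And>z. z \<in> cball 0 1 \<Longrightarrow> c z * q z + d z * g z = 1"
    using assms(1,2) unfolding disc_comaximal_def by metis
  \<comment> \<open>Multiply out \<open>1 = (a p + b g) (c q + d g)\<close>, with the second factor being 1 in the term \<open>b g\<close>.\<close>
  have "(a z * c z) * (p z * q z) + (a z * p z * d z + b z) * g z = 1" if "z \<in> cball 0 1" for z
  proof -
    have "(a z * c z) * (p z * q z) + (a z * p z * d z + b z) * g z
        = a z * p z * (c z * q z + d z * g z) + b z * g z"
      by (simp add: algebra_simps)
    then show ?thesis using eq[OF that] by simp
  qed
  moreover have "(\<lambda>z. a z * c z) \<in> disc_algebra" "(\<lambda>z. a z * p z * d z + b z) \<in> disc_algebra"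
    using ab assms by (auto intro!: disc_algebra_mult disc_algebra_add)
  ultimately show ?thesis
    unfolding disc_comaximal_def by fast
qed

text \<open>Dilations \<open>f (r z)\<close> with \<open>r < 1\<close> converge uniformly to \<open>f\<close>, and each of them is a uniform
  limit of its Taylor polynomials.\<close>

lemma disc_algebra_polynomial_approx:
  assumes f: "f \<in> disc_algebra" and e: "e > 0"
  obtains P where "\<And>z. z \<in> cball 0 1 \<Longrightarrow> norm (poly P z - f z) < e"
proof -
  have cont: "continuous_on (cball 0 1) f" and hol: "f holomorphic_on ball 0 1"
    using f by (auto simp: disc_algebra_def)
  have "uniformly_continuous_on (cball 0 1) f"
    by (intro compact_uniformly_continuous cont) auto
  then obtain d where d: "d > 0"
    "\<And>x y. x \<in> cball 0 1 \<Longrightarrow> y \<in> cball 0 1 \<Longrightarrow> dist y x < d \<Longrightarrow> dist (f y) (f x) < e/2"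
    using e unfolding uniformly_continuous_on_def by (metis half_gt_zero)
  define r where "r = max (1/2) (1 - d/2)"
  have r: "0 < r" "r < 1" "1 - r < d" using d by (auto simp: r_def)
  define c where "c = (\<lambda>n. (deriv ^^ n) f 0 / fact n)"
  have sums: "(\<lambda>n. c n * w ^ n) sums f w" if "w \<in> ball 0 1" for w
    using holomorphic_power_series[OF hol that] by (simp add: c_def)
  have "summable (\<lambda>n. norm (c n * of_real r ^ n))"
  proof (rule powser_insidea)
    show "summable (\<lambda>n. c n * (of_real ((1 + r) / 2)) ^ n)"
      using sums[of "of_real ((1 + r)/2)"] r by (intro sums_summable) (auto simp del: of_real_divide of_real_add)
    show "norm (of_real r :: complex) < norm (of_real ((1 + r) / 2) :: complex)"
      using r by (simp del: of_real_divide of_real_add)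
  qed
  then have summ: "summable (\<lambda>n. norm (c n) * r ^ n)"
    using r by (simp add: norm_mult norm_power)
  then obtain N where N: "norm (\<Sum>n. norm (c (n + N)) * r ^ (n + N)) < e/2"
    using suminf_exist_split[OF _ summ, of "e/2"] e by auto
  define P where "P = (\<Sum>n<N. monom (c n * of_real r ^ n) n)"
  have "norm (poly P z - f z) < e" if z: "z \<in> cball 0 1" for z
  proof -
    define w where "w = of_real r * z"
    have nz: "norm z \<le> 1" using z by simp
    have nw: "norm w \<le> r" using nz r by (simp add: w_def norm_mult mult_left_le)
    have w: "w \<in> ball 0 1" using nw r by simp
    have "z - w = of_real (1 - r) * z"
      by (simp add: w_def algebra_simps)
    then have "norm (z - w) = (1 - r) * norm z"
      using r by (simp only: norm_mult norm_of_real)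
    also have "\<dots> \<le> 1 - r" using nz r by (intro mult_left_le) auto
    also have "\<dots> < d" by (rule r)
    finally have "dist (f w) (f z) < e/2"
      using z w by (intro d) (auto simp: dist_norm norm_minus_commute)
    moreover have "norm (f w - poly P z) < e/2"
    proof -
      have Pz: "poly P z = (\<Sum>n<N. c n * w ^ n)"
        by (simp add: P_def poly_sum poly_monom w_def power_mult_distrib mult_ac)
      have sm: "summable (\<lambda>n. c n * w ^ n)" using sums[OF w] by (rule sums_summable)
      have "f w - poly P z = (\<Sum>n. c (n + N) * w ^ (n + N))"
        using suminf_minus_initial_segment[OF sm, of N] sums_unique[OF sums[OF w]]
        by (simp add: Pz)
      also have "norm \<dots> \<le> (\<Sum>n. norm (c (n + N)) * r ^ (n + N))"
      proof (rule norm_suminf_le)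
        show "norm (c (n + N) * w ^ (n + N)) \<le> norm (c (n + N)) * r ^ (n + N)" for n
          using nw by (auto simp: norm_mult norm_power intro!: mult_left_mono power_mono)
        show "summable (\<lambda>n. norm (c (n + N)) * r ^ (n + N))"
          using summable_ignore_initial_segment[OF summ] .
      qed
      also have "\<dots> < e/2" using N by simp
      finally show ?thesis .
    qed
    ultimately show ?thesis
      using norm_triangle_ineq[of "poly P z - f w" "f w - f z"]
      by (simp add: dist_norm norm_minus_commute)
  qed
  then show thesis using that by blast
qed

section \<open>Units modulo the ideal generated by one function\<close>

definition congruent_to_unit :: "(complex \<Rightarrow> complex) \<Rightarrow> (complex \<Rightarrow> complex) \<Rightarrow> bool" where
  "congruent_to_unit g f \<longleftrightarrow>
     (\<exists>u\<in>real_disc_algebra_units. \<exists>k\<in>real_disc_algebra. \<forall>z\<in>cball 0 1. f z = u z + k z * g z)"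

lemma congruent_to_unitI:
  assumes "u \<in> real_disc_algebra" "\<And>z. z \<in> cball 0 1 \<Longrightarrow> u z \<noteq> 0" "k \<in> real_disc_algebra"
    and "\<And>z. z \<in> cball 0 1 \<Longrightarrow> f z = u z + k z * g z"
  shows "congruent_to_unit g f"
  unfolding congruent_to_unit_def
  using assms by (intro bexI[of _ u] bexI[of _ k]) (auto simp: real_disc_algebra_units_iff)

lemma congruent_to_unitE:
  assumes "congruent_to_unit g f"
  obtains u k where "u \<in> real_disc_algebra" "\<And>z. z \<in> cball 0 1 \<Longrightarrow> u z \<noteq> 0"
    "k \<in> real_disc_algebra" "\<And>z. z \<in> cball 0 1 \<Longrightarrow> f z = u z + k z * g z"
  using assms unfolding congruent_to_unit_def Bex_def real_disc_algebra_units_iff by blast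

lemma congruent_to_unit_unit:
  assumes "u \<in> real_disc_algebra" "\<And>z. z \<in> cball 0 1 \<Longrightarrow> u z \<noteq> 0"
  shows "congruent_to_unit g u"
  by (rule congruent_to_unitI[OF assms real_disc_algebra_0]) auto

lemma congruent_to_unit_mult:
  assumes g: "g \<in> real_disc_algebra" and "congruent_to_unit g p" "congruent_to_unit g q"
  shows "congruent_to_unit g (\<lambda>z. p z * q z)"
proof -
  obtain u k where u: "u \<in> real_disc_algebra" "\<And>z. z \<in> cball 0 1 \<Longrightarrow> u z \<noteq> 0"
    "k \<in> real_disc_algebra" "\<And>z. z \<in> cball 0 1 \<Longrightarrow> p z = u z + k z * g z"
    by (rule congruent_to_unitE[OF assms(2)]) (rule that)
  obtain v l where v: "v \<in> real_disc_algebra" "\<And>z. z \<in> cball 0 1 \<Longrightarrow> v z \<noteq> 0"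
    "l \<in> real_disc_algebra" "\<And>z. z \<in> cball 0 1 \<Longrightarrow> q z = v z + l z * g z"
    by (rule congruent_to_unitE[OF assms(3)]) (rule that)
  show ?thesis
  proof (rule congruent_to_unitI)
    show "(\<lambda>z. u z * v z) \<in> real_disc_algebra"
      "(\<lambda>z. k z * v z + u z * l z + k z * l z * g z) \<in> real_disc_algebra"
      using u v g by (auto intro!: real_disc_algebra_intros)
  qed (use u v in \<open>auto simp: algebra_simps\<close>)
qed

lemma congruent_to_unit_transfer:
  assumes f: "congruent_to_unit g f"
    and w: "w \<in> real_disc_algebra" "\<And>z. z \<in> cball 0 1 \<Longrightarrow> w z \<noteq> 0"
    and l: "l \<in> real_disc_algebra"
    and h: "\<And>z. z \<in> cball 0 1 \<Longrightarrow> h z = f z * w z + l z * g z"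
  shows "congruent_to_unit g h"
proof -
  obtain u k where u: "u \<in> real_disc_algebra" "\<And>z. z \<in> cball 0 1 \<Longrightarrow> u z \<noteq> 0"
    "k \<in> real_disc_algebra" "\<And>z. z \<in> cball 0 1 \<Longrightarrow> f z = u z + k z * g z"
    by (rule congruent_to_unitE[OF f]) (rule that)
  show ?thesis
  proof (rule congruent_to_unitI)
    show "(\<lambda>z. u z * w z) \<in> real_disc_algebra" "(\<lambda>z. k z * w z + l z) \<in> real_disc_algebra"
      using u w l by (auto intro!: real_disc_algebra_intros)
  qed (use u w h in \<open>auto simp: algebra_simps\<close>)
qed

text \<open>If \<open>a f + b g = 1\<close>, then \<open>f (1 + a (h - f)) = h - b (h - f) g\<close>, so modulo \<open>g\<close> the functions
  \<open>f\<close> and \<open>h\<close> differ by the factor \<open>1 + a (h - f)\<close>, which is a unit once \<open>h\<close> is close to \<open>f\<close>.\<close>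
lemma congruent_to_unit_locally_constant:
  assumes fg: "(f, g) \<in> invertible_pairs"
  obtains e where "e > 0" "\<And>h. h \<in> real_disc_algebra \<Longrightarrow>
    \<forall>z\<in>cball 0 1. norm (h z - f z) \<le> e \<Longrightarrow>
    congruent_to_unit g h \<longleftrightarrow> congruent_to_unit g f"
proof -
  obtain a b where ab: "a \<in> real_disc_algebra" "b \<in> real_disc_algebra"
    and eq: "\<And>z. z \<in> cball 0 1 \<Longrightarrow> a z * f z + b z * g z = 1"
    and f: "f \<in> real_disc_algebra" and g: "g \<in> real_disc_algebra"
    using fg unfolding invertible_pairs_def by blast
  obtain B where B: "B > 0" "\<And>z. z \<in> cball 0 1 \<Longrightarrow> norm (a z) \<le> B"
    using disc_algebra_bounded[OF real_disc_algebraD(1)[OF ab(1)]] by blast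
  show thesis
  proof (rule that)
    show "1 / (2 * B) > 0" using B by simp
    fix h assume h: "h \<in> real_disc_algebra"
      and close: "\<forall>z\<in>cball 0 1. norm (h z - f z) \<le> 1 / (2 * B)"
    define w where "w = (\<lambda>z. 1 + a z * (h z - f z))"
    have w: "w \<in> real_disc_algebra"
      unfolding w_def by (intro real_disc_algebra_intros ab h f)
    have w0: "w z \<noteq> 0" if z: "z \<in> cball 0 1" for z
    proof
      assume "w z = 0"
      then have "a z * (h z - f z) = - 1"
        by (simp add: w_def add_eq_0_iff)
      then have "norm (a z) * norm (h z - f z) = 1"
        by (metis norm_minus_cancel norm_mult norm_one)
      moreover have "norm (a z) * norm (h z - f z) \<le> B * (1 / (2 * B))"
        using B z close by (intro mult_mono) auto
      ultimately show False using B by simp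
    qed
    have l: "(\<lambda>z. b z * (h z - f z)) \<in> real_disc_algebra"
      by (intro real_disc_algebra_intros ab h f)
    have l': "(\<lambda>z. - (inverse (w z) * (b z * (h z - f z)))) \<in> real_disc_algebra"
      by (intro real_disc_algebra_intros ab h f w w0)
    have w': "(\<lambda>z. inverse (w z)) \<in> real_disc_algebra"
      by (intro real_disc_algebra_intros w w0)
    have hf: "h z = f z * w z + b z * (h z - f z) * g z" if "z \<in> cball 0 1" for z
    proof -
      have "f z * w z + b z * (h z - f z) * g z
          = f z + (a z * f z + b z * g z) * (h z - f z)"
        by (simp add: w_def algebra_simps)
      then show ?thesis using eq[OF that] by simp
    qed
    show "congruent_to_unit g h \<longleftrightarrow> congruent_to_unit g f"
    proof
      assume "congruent_to_unit g f"
      then show "congruent_to_unit g h"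
        by (rule congruent_to_unit_transfer[OF _ w w0 l hf])
    next
      assume h: "congruent_to_unit g h"
      show "congruent_to_unit g f"
      proof (rule congruent_to_unit_transfer[OF h w' _ l'])
        show "f z = h z * inverse (w z) + - (inverse (w z) * (b z * (h z - f z))) * g z"
          if "z \<in> cball 0 1" for z
        proof -
          have "f z * w z = h z - b z * (h z - f z) * g z"
            by (subst eq_diff_eq) (rule hf[OF that, symmetric])
          then have "f z = (h z - b z * (h z - f z) * g z) * inverse (w z)"
            using w0[OF that] by (simp add: nonzero_eq_divide_eq flip: divide_inverse)
          then show ?thesis by (simp add: algebra_simps)
        qed
      qed (use w0 in auto)
    qed
  qed
qed

lemma congruent_to_unit_connected_family:
  fixes F :: "'a::topological_space \<Rightarrow> complex \<Rightarrow> complex"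
  assumes T: "connected T" "s \<in> T" "t \<in> T"
    and cont: "continuous_on (T \<times> cball 0 1) (\<lambda>(t, z). F t z)"
    and inv: "\<And>t. t \<in> T \<Longrightarrow> (F t, g) \<in> invertible_pairs"
  shows "congruent_to_unit g (F s) \<longleftrightarrow> congruent_to_unit g (F t)"
proof (rule connected_equivalence_relation[OF T])
  fix a assume a: "a \<in> T"
  obtain e where e: "e > 0" "\<And>h. h \<in> real_disc_algebra \<Longrightarrow>
    \<forall>z\<in>cball 0 1. norm (h z - F a z) \<le> e \<Longrightarrow>
    congruent_to_unit g h \<longleftrightarrow> congruent_to_unit g (F a)"
    by (rule congruent_to_unit_locally_constant[OF inv[OF a]]) (rule that)
  obtain X where X: "a \<in> X" "open X"
    "\<forall>x\<in>X \<inter> T. \<forall>z\<in>cball 0 1. dist (F x z) (F a z) \<le> e"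
    by (rule continuous_on_prod_compactE[OF cont compact_cball a e(1)]) (simp add: that)
  have "congruent_to_unit g (F a) \<longleftrightarrow> congruent_to_unit g (F x)" if "x \<in> T \<inter> X" for x
  proof -
    have "F x \<in> real_disc_algebra"
      using inv[of x] that by (auto simp: invertible_pairs_def)
    then show ?thesis
      using e(2)[of "F x"] X(3) that by (auto simp: dist_norm)
  qed
  then show "\<exists>U. openin (top_of_set T) U \<and> a \<in> U \<and>
      (\<forall>x\<in>U. congruent_to_unit g (F a) \<longleftrightarrow> congruent_to_unit g (F x))"
    using X a by (intro exI[of _ "T \<inter> X"]) (auto simp: openin_open_Int)
qed auto

section \<open>The zero set of a disc algebra function\<close>

lemma disc_algebra_nonzero_on_circle:
  assumes g: "g \<in> disc_algebra" and nz: "w \<in> cball 0 1" "g w \<noteq> 0"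
  obtains c where "norm c = 1" "g c \<noteq> 0"
proof -
  have "\<exists>c. norm c = 1 \<and> g c \<noteq> 0"
  proof (rule ccontr)
    assume *: "\<not> (\<exists>c. norm c = 1 \<and> g c \<noteq> 0)"
    have "norm (g w) \<le> 0"
    proof (rule maximum_modulus_frontier[of g "cball 0 1" 0 w])
      show "g holomorphic_on interior (cball 0 1)" "continuous_on (closure (cball 0 1)) g"
        using g by (simp_all add: disc_algebra_def)
      show "norm (g z) \<le> 0" if "z \<in> frontier (cball 0 1)" for z
        using * that by auto
    qed (use nz in auto)
    then show False using nz by simp
  qed
  then show thesis using that by blast
qed

lemma disc_algebra_countable_zeros:
  assumes g: "g \<in> disc_algebra" and nz: "w \<in> cball 0 1" "g w \<noteq> 0"
  shows "countable {z \<in> ball 0 1. g z = 0}"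
proof (cases "g constant_on ball 0 1")
  case False
  have "ball 0 1 = (\<Union>n. cball (0 :: complex) (1 - inverse (real (Suc n))))"
  proof (intro equalityI subsetI)
    fix z :: complex assume "z \<in> ball 0 1"
    then obtain n where "inverse (real (Suc n)) < 1 - norm z"
      using reals_Archimedean[of "1 - norm z"] by auto
    then have "z \<in> cball 0 (1 - inverse (real (Suc n)))" by simp
    then show "z \<in> (\<Union>n. cball 0 (1 - inverse (real (Suc n))))" by blast
  next
    fix z :: complex assume "z \<in> (\<Union>n. cball 0 (1 - inverse (real (Suc n))))"
    then obtain n where "norm z \<le> 1 - inverse (real (Suc n))" by auto
    moreover have "inverse (real (Suc n)) > 0" by simp
    ultimately show "z \<in> ball 0 1" unfolding mem_ball_0 by linarith
  qed
  then have "fsigma (ball 0 1 :: complex set)"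
    using fsigma.intros[of "\<lambda>n. cball (0 :: complex) (1 - inverse (real (Suc n)))"] by simp
  then show ?thesis
    using g False by (intro holomorphic_countable_zeros) (auto simp: disc_algebra_def)
next
  case True
  then obtain c where c: "\<And>z. z \<in> ball 0 1 \<Longrightarrow> g z = c"
    by (auto simp: constant_on_def)
  have "g w = c"
    using g nz(1) c
    by (intro continuous_constant_on_closure[of "ball 0 1" g c w]) (auto simp: disc_algebra_def)
  then have "{z \<in> ball 0 1. g z = 0} = {}" using c nz by auto
  then show ?thesis by (metis countable_empty)
qed

text \<open>Inside the open disc only countably many points are removed, so the rest is connected and dense
  in the disc; the exterior of the closed disc is connected as well. Adding to each of them the
  points of the circle where \<open>g\<close> does not vanish preserves connectedness, and the two sets so
  obtained share such a point by the maximum modulus principle.\<close>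
lemma connected_complement_zeros:
  assumes g: "g \<in> disc_algebra" and nz: "w \<in> cball 0 1" "g w \<noteq> 0"
  shows "connected (- {z \<in> cball 0 1. g z = 0})"
proof -
  define Z where "Z = {z \<in> ball 0 1. g z = 0}"
  have Z: "countable Z" unfolding Z_def by (rule disc_algebra_countable_zeros[OF assms])
  obtain c where c: "norm c = 1" "g c \<noteq> 0" by (rule disc_algebra_nonzero_on_circle[OF assms])
  define A where "A = {z \<in> cball 0 1. g z \<noteq> 0}"
  define B where "B = {z. norm z \<ge> 1 \<and> (norm z = 1 \<longrightarrow> g z \<noteq> 0)}"
  have "connected A"
  proof (rule connected_intermediate_closure)
    show "connected (ball 0 1 - Z)"
      by (intro connected_open_diff_countable Z) auto
    show "ball 0 1 - Z \<subseteq> A" by (auto simp: A_def Z_def)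
    have "ball 0 1 \<subseteq> closure (ball 0 1 - Z)"
    proof
      fix x :: complex assume x: "x \<in> ball 0 1"
      show "x \<in> closure (ball 0 1 - Z)"
        unfolding closure_approachable
      proof (intro allI impI)
        fix e :: real assume "e > 0"
        then obtain d where d: "d > 0" "ball x d \<subseteq> ball 0 1 \<inter> ball x e"
          using x by (metis IntI centre_in_ball open_Int open_ball open_contains_ball)
        then obtain y where "y \<in> ball x d - Z"
          using ball_minus_countable_nonempty[OF Z] by blast
        with d show "\<exists>y\<in>ball 0 1 - Z. dist y x < e"
          by (intro bexI[of _ y]) (auto simp: dist_commute subset_iff)
      qed
    qed
    then have "closure (ball 0 1) \<subseteq> closure (ball 0 1 - Z)"
      by (intro closure_minimal) auto
    then show "A \<subseteq> closure (ball 0 1 - Z)" by (auto simp: A_def)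
  qed
  moreover have "connected B"
  proof (rule connected_intermediate_closure)
    show "connected (- cball 0 1 :: complex set)"
      by (rule connected_complement_bounded_convex) auto
    show "- cball 0 1 \<subseteq> B" by (auto simp: B_def)
    show "B \<subseteq> closure (- cball 0 1)" by (auto simp: B_def closure_complement)
  qed
  moreover have "c \<in> A \<inter> B" using c by (simp add: A_def B_def)
  then have "A \<inter> B \<noteq> {}" by blast
  ultimately have "connected (A \<union> B)" by (intro connected_Un)
  moreover have "A \<union> B = - {z \<in> cball 0 1. g z = 0}" by (auto simp: A_def B_def)
  ultimately show ?thesis by simp
qed

section \<open>Linear and quadratic factors\<close>

text \<open>The quotient \<open>(g z - g a) / (z - a)\<close> need not extend continuously to \<open>a\<close> if \<open>a\<close> lies on the
  unit circle. Therefore the division by \<open>z - a\<close> is performed on a polynomial \<open>P\<close> approximating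
  \<open>g\<close>: the function \<open>P a - (P z - g z)\<close> lies in the ideal of \<open>z - a\<close> and \<open>g\<close>, and it is a
  unit because \<open>P a\<close> is bounded away from 0.\<close>
lemma disc_comaximal_linear:
  assumes g: "g \<in> disc_algebra" and a: "a \<in> cball 0 1 \<Longrightarrow> g a \<noteq> 0"
  shows "disc_comaximal g (\<lambda>z. z - a)"
proof (cases "a \<in> cball 0 1")
  case False
  then have nz: "z - a \<noteq> 0" if "z \<in> cball 0 1" for z using that by auto
  have "(\<lambda>z. inverse (z - a)) \<in> disc_algebra"
    using nz by (intro disc_algebra_inverse disc_algebra_diff disc_algebra_id disc_algebra_const) auto
  moreover have "inverse (z - a) * (z - a) + 0 * g z = 1" if "z \<in> cball 0 1" for z
    using nz[OF that] by simp
  ultimately show ?thesis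
    using disc_algebra_const[of 0] unfolding disc_comaximal_def by (metis (no_types, lifting))
next
  case True
  define e where "e = norm (g a) / 2"
  have e: "e > 0" using a True by (simp add: e_def)
  obtain P where P: "\<And>z. z \<in> cball 0 1 \<Longrightarrow> norm (poly P z - g z) < e"
    using disc_algebra_polynomial_approx[OF g e] by blast
  define Q where "Q = synthetic_div P a"
  have Q: "poly P z = (z - a) * poly Q z + poly P a" for z
    using arg_cong[OF synthetic_div_correct'[of a P], of "\<lambda>p. poly p z"]
    by (simp add: Q_def algebra_simps)
  define s where "s = (\<lambda>z. poly P a - (poly P z - g z))"
  have s0: "s z \<noteq> 0" if "z \<in> cball 0 1" for z
  proof
    assume "s z = 0"
    then have "norm (poly P a) < e" using P[OF that] by (simp add: s_def)
    moreover have "norm (g a) \<le> norm (poly P a) + norm (poly P a - g a)"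
      using norm_triangle_ineq4[of "poly P a" "poly P a - g a"] by simp
    ultimately show False using P[OF True] by (simp add: e_def)
  qed
  have s: "(\<lambda>z. inverse (s z)) \<in> disc_algebra"
    unfolding s_def
    by (rule disc_algebra_inverse)
       (use s0 in \<open>auto simp: s_def intro!: disc_algebra_diff disc_algebra_const disc_algebra_poly g\<close>)
  have "(\<lambda>z. - (inverse (s z) * poly Q z)) \<in> disc_algebra"
    by (intro disc_algebra_uminus disc_algebra_mult s disc_algebra_poly)
  moreover have "- (inverse (s z) * poly Q z) * (z - a) + inverse (s z) * g z = 1"
    if "z \<in> cball 0 1" for z
  proof -
    have "- (inverse (s z) * poly Q z) * (z - a) + inverse (s z) * g z
        = inverse (s z) * (g z - (z - a) * poly Q z)"
      by (simp add: algebra_simps)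
    also have "g z - (z - a) * poly Q z = s z"
      using Q[of z] by (simp add: s_def)
    finally show ?thesis using s0[OF that] by simp
  qed
  ultimately show ?thesis
    using s unfolding disc_comaximal_def by (metis (no_types, lifting))
qed

text \<open>Move \<open>a\<close> in the complement of the zero set to the point 2. The conjugate root moves along, and it
  also stays off the zero set, which is symmetric.\<close>
lemma congruent_to_unit_conjugate_factors:
  assumes g: "g \<in> real_disc_algebra" and nz: "w \<in> cball 0 1" "g w \<noteq> 0"
    and a: "a \<in> cball 0 1 \<Longrightarrow> g a \<noteq> 0"
  shows "congruent_to_unit g (\<lambda>z. (z - a) * (z - cnj a))"
proof -
  note gd = real_disc_algebraD(1)[OF g]
  define T where "T = - {z \<in> cball 0 1. g z = 0}"
  define F where "F = (\<lambda>t z. (z - t) * (z - cnj t))"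
  have T: "connected T" "a \<in> T" "2 \<in> T"
    unfolding T_def using connected_complement_zeros[OF gd nz] a by auto
  have real: "F t \<in> real_disc_algebra" for t
    unfolding F_def
    by (intro real_disc_algebraI disc_algebra_mult disc_algebra_diff disc_algebra_id
        disc_algebra_const) simp
  have "congruent_to_unit g (F a) \<longleftrightarrow> congruent_to_unit g (F 2)"
  proof (rule congruent_to_unit_connected_family[OF T])
    show "continuous_on (T \<times> cball 0 1) (\<lambda>(t, z). F t z)"
      unfolding F_def split_beta by (intro continuous_intros)
    fix t assume t: "t \<in> T"
    have "cnj t \<in> cball 0 1 \<Longrightarrow> g (cnj t) \<noteq> 0"
      using t real_disc_algebraD(2)[OF g, of t] by (auto simp: T_def)
    then have "disc_comaximal g (F t)"
      unfolding F_def using t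
      by (intro disc_comaximal_mult disc_comaximal_linear gd disc_algebra_diff disc_algebra_id
          disc_algebra_const) (auto simp: T_def)
    then show "(F t, g) \<in> invertible_pairs"
      by (rule disc_comaximal_imp_invertible_pair[OF real g])
  qed
  moreover have "congruent_to_unit g (F 2)"
    by (rule congruent_to_unit_unit[OF real]) (auto simp: F_def)
  ultimately show ?thesis by (simp add: F_def)
qed

text \<open>The root \<open>a\<close> moves within \<open>T\<close> to the point \<open>b\<close> outside the closed disc.\<close>
lemma congruent_to_unit_real_linear:
  assumes g: "g \<in> real_disc_algebra" and T: "connected T" "a \<in> T" "b \<in> T" "\<bar>b\<bar> > 1"
    and nz: "\<And>x. x \<in> T \<Longrightarrow> x \<in> {-1..1} \<Longrightarrow> g (of_real x) \<noteq> 0"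
  shows "congruent_to_unit g (\<lambda>z. z - of_real a)"
proof -
  define F where "F = (\<lambda>(t::real) z. z - complex_of_real t)"
  have real: "F t \<in> real_disc_algebra" for t
    unfolding F_def by (intro real_disc_algebra_intros)
  have "congruent_to_unit g (F a) \<longleftrightarrow> congruent_to_unit g (F b)"
  proof (rule congruent_to_unit_connected_family[OF T(1-3)])
    show "continuous_on (T \<times> cball 0 1) (\<lambda>(t, z). F t z)"
      unfolding F_def split_beta by (intro continuous_intros)
    fix t assume t: "t \<in> T"
    have "disc_comaximal g (F t)"
      unfolding F_def using nz[OF t]
      by (intro disc_comaximal_linear real_disc_algebraD(1)[OF g]) (auto simp: abs_le_iff)
    then show "(F t, g) \<in> invertible_pairs"
      by (rule disc_comaximal_imp_invertible_pair[OF real g])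
  qed
  moreover have "congruent_to_unit g (F b)"
    by (rule congruent_to_unit_unit[OF real]) (use T in \<open>auto simp: F_def\<close>)
  ultimately show ?thesis by (simp add: F_def)
qed

text \<open>Move \<open>b\<close> to \<open>a\<close>: a double real root is a pair of conjugate roots, which may then leave the
  real axis.\<close>
lemma congruent_to_unit_real_pair:
  fixes a b :: real
  assumes g: "g \<in> real_disc_algebra" and w: "w \<in> cball 0 1" "g w \<noteq> 0"
    and nz: "\<And>x. x \<in> closed_segment a b \<Longrightarrow> x \<in> {-1..1} \<Longrightarrow> g (of_real x) \<noteq> 0"
  shows "congruent_to_unit g (\<lambda>z. (z - of_real a) * (z - of_real b))"
proof -
  note gd = real_disc_algebraD(1)[OF g]
  define F where "F = (\<lambda>(t::real) z. (z - complex_of_real a) * (z - complex_of_real t))"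
  have real: "F t \<in> real_disc_algebra" for t
    unfolding F_def by (intro real_disc_algebra_intros)
  have nz': "complex_of_real x \<in> cball 0 1 \<Longrightarrow> g (of_real x) \<noteq> 0" if "x \<in> closed_segment a b" for x
    using nz[OF that] by (auto simp: abs_le_iff)
  have "congruent_to_unit g (F b) \<longleftrightarrow> congruent_to_unit g (F a)"
  proof (rule congruent_to_unit_connected_family[of "closed_segment a b"])
    show "continuous_on (closed_segment a b \<times> cball 0 1) (\<lambda>(t, z). F t z)"
      unfolding F_def split_beta by (intro continuous_intros)
    fix t assume t: "t \<in> closed_segment a b"
    have "disc_comaximal g (F t)"
      unfolding F_def using nz'[OF t] nz'[of a]
      by (intro disc_comaximal_mult disc_comaximal_linear gd disc_algebra_diff disc_algebra_id
          disc_algebra_const) auto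
    then show "(F t, g) \<in> invertible_pairs"
      by (rule disc_comaximal_imp_invertible_pair[OF real g])
  qed auto
  moreover have "congruent_to_unit g (F a)"
    using congruent_to_unit_conjugate_factors[OF g w, of "of_real a"] nz'[of a] by (simp add: F_def)
  ultimately show ?thesis by (simp add: F_def)
qed

section \<open>Polynomials with real coefficients\<close>

text \<open>A polynomial with real coefficients is a complex polynomial fixed by \<open>map_poly cnj\<close>, so that its
  nonreal roots are available.\<close>
lemma map_poly_cnj_mult: "map_poly cnj (p * q) = map_poly cnj p * map_poly cnj q"
  by (simp add: fun_eq_iff flip: poly_eq_poly_eq_iff)

lemma poly_cnj_fixed:
  assumes "map_poly cnj p = p"
  shows "poly p (cnj z) = cnj (poly p z)"
  using poly_cnj[of p z] assms by simp

lemma poly_cnj_fixed_of_real: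
  assumes "map_poly cnj p = p"
  shows "Im (poly p (of_real x)) = 0"
  using poly_cnj_fixed[OF assms, of "of_real x"] by (metis Reals_cnj_iff complex_cnj_complex_of_real complex_is_Real_iff)

lemma cnj_fixed_factor:
  assumes "map_poly cnj (d * q) = d * q" "map_poly cnj d = d" "d \<noteq> 0"
  shows "map_poly cnj q = q"
  using assms by (simp add: map_poly_cnj_mult)

lemma real_disc_algebra_poly:
  assumes "map_poly cnj p = p"
  shows "poly p \<in> real_disc_algebra"
  by (intro real_disc_algebraI disc_algebra_poly poly_cnj_fixed assms)

lemma real_disc_algebra_polynomial_approx:
  assumes f: "f \<in> real_disc_algebra" and e: "e > 0"
  obtains p where "map_poly cnj p = p" "\<And>z. z \<in> cball 0 1 \<Longrightarrow> norm (poly p z - f z) < e"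
proof -
  obtain P where P: "\<And>z. z \<in> cball 0 1 \<Longrightarrow> norm (poly P z - f z) < e"
    using disc_algebra_polynomial_approx[OF real_disc_algebraD(1)[OF f] e] by blast
  define p where "p = smult (1/2) (P + map_poly cnj P)"
  have "map_poly cnj p = p"
    by (intro poly_eqI) (simp add: p_def coeff_map_poly add.commute)
  moreover have "norm (poly p z - f z) < e" if z: "z \<in> cball 0 1" for z
  proof -
    have "norm (cnj (poly P (cnj z)) - f z) = norm (cnj (poly P (cnj z) - f (cnj z)))"
      using real_disc_algebraD(2)[OF f z] by simp
    also have "\<dots> < e" unfolding complex_mod_cnj using P[of "cnj z"] z by simp
    finally have 1: "norm (cnj (poly P (cnj z)) - f z) < e" .
    have "2 * (poly p z - f z) = (poly P z - f z) + (cnj (poly P (cnj z)) - f z)"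
      by (simp add: p_def)
    then have "2 * norm (poly p z - f z) = norm ((poly P z - f z) + (cnj (poly P (cnj z)) - f z))"
      by (metis norm_mult norm_numeral)
    also have "\<dots> < 2 * e"
      using norm_triangle_ineq[of "poly P z - f z" "cnj (poly P (cnj z)) - f z"] 1 P[OF z] by linarith
    finally show ?thesis by simp
  qed
  ultimately show thesis using that by blast
qed

text \<open>Induction on the degree: from a nonconstant polynomial, a liftable divisor with real coefficients
  is split off that is positive at the real zeros of \<open>g\<close>, so that the cofactor inherits the positivity.\<close>
lemma congruent_to_unit_poly:
  assumes g: "g \<in> real_disc_algebra" and w: "w \<in> cball 0 1" "g w \<noteq> 0"
    and "p \<noteq> 0" "map_poly cnj p = p"
    and "\<And>z. z \<in> cball 0 1 \<Longrightarrow> g z = 0 \<Longrightarrow> poly p z \<noteq> 0"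
    and "\<And>x. x \<in> {-1..1} \<Longrightarrow> g (of_real x) = 0 \<Longrightarrow> Re (poly p (of_real x)) > 0"
  shows "congruent_to_unit g (poly p)"
  using assms(4-)
proof (induction "degree p" arbitrary: p rule: less_induct)
  case less
  note p = less.prems
  have split_off: "congruent_to_unit g (poly p)"
    if d: "p = d * q" "degree d > 0" "map_poly cnj d = d" "congruent_to_unit g (poly d)"
      and dpos: "\<And>x. x \<in> {-1..1} \<Longrightarrow> g (of_real x) = 0 \<Longrightarrow> Re (poly d (of_real x)) > 0" for d q
  proof -
    have nz: "d \<noteq> 0" "q \<noteq> 0" using p(1) d(1) by auto
    have "congruent_to_unit g (poly q)"
    proof (rule less.hyps)
      show "degree q < degree p" using nz d by (simp add: degree_mult_eq)
      show "map_poly cnj q = q" 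
        by (rule cnj_fixed_factor[OF p(2)[unfolded d(1)] d(3) nz(1)])
      show "poly q z \<noteq> 0" if "z \<in> cball 0 1" "g z = 0" for z using p(3)[OF that] d(1) by auto
      show "Re (poly q (of_real x)) > 0" if x: "x \<in> {-1..1}" "g (of_real x) = 0" for x
      proof -
        have "0 < Re (poly d (of_real x)) * Re (poly q (of_real x))"
          using p(4)[OF x] poly_cnj_fixed_of_real[OF d(3)] by (simp add: d(1))
        then show ?thesis using dpos[OF x] by (rule zero_less_mult_pos)
      qed
    qed (rule nz)
    then have "congruent_to_unit g (\<lambda>z. poly d z * poly q z)"
      by (rule congruent_to_unit_mult[OF g d(4)])
    moreover have "poly p = (\<lambda>z. poly d z * poly q z)"
      by (simp add: d(1) fun_eq_iff)
    ultimately show ?thesis by (simp only:)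
  qed
  show ?case
  proof (cases "degree p = 0")
    case True
    then obtain c where c: "p = [:c:]" using degree_eq_zeroE by blast
    show ?thesis
      by (rule congruent_to_unit_unit[OF real_disc_algebra_poly[OF p(2)]]) (use p(1) c in auto)
  next
    case False
    then obtain r where r: "poly p r = 0" using alg_closed_imp_poly_has_root[of p] by auto
    show ?thesis
    proof (cases "Im r = 0")
      case False
      then have "cnj r \<noteq> r" by (simp add: complex_eq_iff)
      obtain q1 where q1: "p = [:-r, 1:] * q1" using r by (auto simp: poly_eq_0_iff_dvd elim: dvdE)
      have "poly p (cnj r) = 0" using poly_cnj_fixed[OF p(2), of r] r by simp
      then have "poly q1 (cnj r) = 0" using q1 \<open>cnj r \<noteq> r\<close> by simp
      then obtain q where q: "q1 = [:-cnj r, 1:] * q" by (auto simp: poly_eq_0_iff_dvd elim: dvdE)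
      define d where "d = [:-r, 1:] * [:-cnj r, 1:]"
      have dz: "poly d z = (z - r) * (z - cnj r)" for z by (simp add: d_def algebra_simps)
      show ?thesis
      proof (rule split_off)
        show "p = d * q" by (simp only: q1 q d_def mult.assoc)
        show "degree d > 0" by (simp add: d_def degree_mult_eq)
        show "map_poly cnj d = d"
          unfolding d_def map_poly_cnj_mult by (simp add: map_poly_pCons mult.commute)
        have "congruent_to_unit g (\<lambda>z. (z - r) * (z - cnj r))"
          using p(3) r by (intro congruent_to_unit_conjugate_factors[OF g w]) auto
        moreover have "poly d = (\<lambda>z. (z - r) * (z - cnj r))" by (rule ext) (rule dz)
          ultimately show "congruent_to_unit g (poly d)" by (simp only:)
        show "Re (poly d (of_real x)) > 0" for x
        proof -
          have "poly d (of_real x) = of_real ((norm (of_real x - r))\<^sup>2)"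
            using complex_norm_square[of "of_real x - r"] by (simp add: dz)
          moreover have "of_real x \<noteq> r" using False by auto
          ultimately show ?thesis by simp
        qed
      qed
    next
      case True
      define a where "a = Re r"
      have ra: "r = of_real a" using True by (simp add: a_def complex_eq_iff)
      define K where "K = {x \<in> {-1..1}. g (of_real x) = 0}"
      have K: "compact K"
      proof -
        have "continuous_on {-1..1} (\<lambda>x. g (complex_of_real x))"
          by (rule disc_algebra_continuous_on_interval[OF real_disc_algebraD(1)[OF g]])
        then have "closed K"
          unfolding K_def by (intro continuous_closed_preimage_constant) auto
        moreover have "K \<subseteq> {-1..1}" by (auto simp: K_def)
        ultimately show ?thesis
          by (meson bounded_closed_interval bounded_subset compact_eq_bounded_closed)
      qed
      have pK: "Re (poly p (of_real x)) > 0" if "x \<in> K" for x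
        using p(4) that by (auto simp: K_def)
      have "a \<notin> K" using pK[of a] r ra by auto
      obtain q where q: "p = [:-of_real a, 1:] * q" using r ra by (auto simp: poly_eq_0_iff_dvd elim: dvdE)
      have cnj_a: "map_poly cnj [:-of_real a, 1:] = [:-of_real a, 1:]"
        by (simp add: map_poly_pCons)
      consider "\<And>x. x \<in> K \<Longrightarrow> a < x" | "\<And>x. x \<in> K \<Longrightarrow> x < a"
        | x y where "x \<in> K" "x < a" "y \<in> K" "a < y"
        using \<open>a \<notin> K\<close> by (metis not_less_iff_gr_or_eq)
      then show ?thesis
      proof cases
        case 1
        have "congruent_to_unit g (\<lambda>z. z - of_real a)"
          by (rule congruent_to_unit_real_linear[OF g, of "{..a}" a "min a (-2)"])
             (use 1 in \<open>force simp: K_def\<close>)+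
        moreover have "poly [:-complex_of_real a, 1:] = (\<lambda>z. z - of_real a)"
          by (simp add: fun_eq_iff)
        ultimately show ?thesis
          using 1 by (intro split_off[OF q _ cnj_a]) (auto simp: K_def)
      next
        case 2
        have "congruent_to_unit g (\<lambda>z. z - of_real a)"
          by (rule congruent_to_unit_real_linear[OF g, of "{a..}" a "max a 2"])
             (use 2 in \<open>force simp: K_def\<close>)+
        then have "congruent_to_unit g (poly [:of_real a, -1:])"
          by (rule congruent_to_unit_transfer[of _ _ "\<lambda>z. -1" "\<lambda>z. 0"])
             (auto intro!: real_disc_algebra_uminus real_disc_algebra_intros)
        moreover have "p = [:of_real a, -1:] * (- q)" by (simp add: q)
        ultimately show ?thesis
          using 2 by (intro split_off[of "[:of_real a, -1:]" "-q"])
            (auto simp: K_def map_poly_pCons)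
      next
        \<comment> \<open>The points \<open>s\<close> and \<open>t\<close> below are the zeros of \<open>g\<close> next to \<open>a\<close>. As \<open>z - a\<close> changes sign between
          them and \<open>p\<close> is positive at both, the cofactor \<open>q\<close> has a root \<open>b\<close> in the same gap.\<close>
        case 3
        have "compact (K \<inter> {..a})" "K \<inter> {..a} \<noteq> {}" using K 3 by (auto intro: compact_Int_closed)
        then obtain s where s: "s \<in> K" "s \<le> a" "\<And>x. x \<in> K \<Longrightarrow> x \<le> a \<Longrightarrow> x \<le> s"
          using compact_attains_sup[of "K \<inter> {..a}"] by auto
        have "compact (K \<inter> {a..})" "K \<inter> {a..} \<noteq> {}" using K 3 by (auto intro: compact_Int_closed)
        then obtain t where t: "t \<in> K" "a \<le> t" "\<And>x. x \<in> K \<Longrightarrow> a \<le> x \<Longrightarrow> t \<le> x"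
          using compact_attains_inf[of "K \<inter> {a..}"] by auto
        have sat: "s < a" "a < t" using s t \<open>a \<notin> K\<close> by (auto simp: less_le)
        have q_real: "map_poly cnj q = q"
          by (rule cnj_fixed_factor[OF p(2)[unfolded q] cnj_a]) simp
        have "0 < (s - a) * Re (poly q (of_real s))" "0 < (t - a) * Re (poly q (of_real t))"
          using pK[OF s(1)] pK[OF t(1)] by (simp_all add: q algebra_simps)
        then have qst: "Re (poly q (of_real s)) < 0" "0 < Re (poly q (of_real t))"
          using sat by (auto simp: zero_less_mult_iff)
        then obtain b where b: "s \<le> b" "b \<le> t" "Re (poly q (of_real b)) = 0"
          using IVT'[of "\<lambda>x. Re (poly q (of_real x))" s 0 t] sat
          by (force intro!: continuous_intros)
        then have sbt: "s < b" "b < t" using qst by (auto simp: less_le)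
        have "poly q (of_real b) = 0"
          using b poly_cnj_fixed_of_real[OF q_real] by (simp add: complex_eq_iff)
        then obtain q' where q': "q = [:-of_real b, 1:] * q'"
          by (auto simp: poly_eq_0_iff_dvd elim: dvdE)
        have gap: "x \<le> s \<or> t \<le> x" if "x \<in> K" for x using s(3) t(3) that by (meson linear)
        define d where "d = [:-complex_of_real a, 1:] * [:-of_real b, 1:]"
        have dz: "poly d z = (z - of_real a) * (z - of_real b)" for z
          by (simp add: d_def algebra_simps)
        show ?thesis
        proof (rule split_off)
          show "p = d * q'" by (simp only: q q' d_def mult.assoc)
          show "degree d > 0" by (simp add: d_def degree_mult_eq)
          show "map_poly cnj d = d"
            unfolding d_def map_poly_cnj_mult by (simp add: map_poly_pCons)
          have "congruent_to_unit g (\<lambda>z. (z - of_real a) * (z - of_real b))"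
          proof (rule congruent_to_unit_real_pair[OF g w])
            fix x assume x: "x \<in> closed_segment a b" "x \<in> {-1..1}"
            then have "s < x" "x < t" using sat sbt by (auto simp: closed_segment_eq_real_ivl split: if_splits)
            then show "g (of_real x) \<noteq> 0" using gap[of x] x by (auto simp: K_def)
          qed
          moreover have "poly d = (\<lambda>z. (z - of_real a) * (z - of_real b))" by (rule ext) (rule dz)
          ultimately show "congruent_to_unit g (poly d)" by (simp only:)
          show "Re (poly d (of_real x)) > 0" if "x \<in> {-1..1}" "g (of_real x) = 0" for x
          proof -
            have "poly d (of_real x) = of_real ((x - a) * (x - b))" by (simp add: dz)
            moreover have "(x - a) * (x - b) > 0"
              using gap[of x] that sat sbt by (auto simp: K_def zero_less_mult_iff)
            ultimately show ?thesis by (metis Re_complex_of_real)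
          qed
        qed
      qed
    qed
  qed
qed

section \<open>Units in a residue class\<close>

text \<open>If \<open>g\<close> has no zeros, every function is congruent to 1; if \<open>g\<close> vanishes identically, \<open>f\<close> is
  itself a unit. Otherwise a polynomial \<open>p\<close> with real coefficients is chosen so close to \<open>f\<close> that
  both are liftable or neither is, and that \<open>p\<close> has no zeros on the zero set of \<open>g\<close> and the sign of \<open>f\<close> on its
  real points.\<close>
theorem congruent_to_unit_if_positive:
  assumes fg: "(f, g) \<in> invertible_pairs"
    and pos: "\<And>x. x \<in> {-1..1} \<Longrightarrow> g (of_real x) = 0 \<Longrightarrow> Re (f (of_real x)) > 0"
  shows "congruent_to_unit g f"
proof -
  have f: "f \<in> real_disc_algebra" and g: "g \<in> real_disc_algebra"
    using fg by (auto simp: invertible_pairs_def)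
  have fg0: "f z \<noteq> 0" if "z \<in> cball 0 1" "g z = 0" for z
    using fg that by (force simp: invertible_pairs_def)
  define Z where "Z = {z \<in> cball 0 1. g z = 0}"
  consider "Z = {}" | "Z = cball 0 1" | "Z \<noteq> {}" "Z \<noteq> cball 0 1" by blast
  then show ?thesis
  proof cases
    case 1
    then have g0: "g z \<noteq> 0" if "z \<in> cball 0 1" for z using that by (auto simp: Z_def)
    show ?thesis
    proof (rule congruent_to_unitI[of "\<lambda>z. 1"])
      show "(\<lambda>z. (f z - 1) * inverse (g z)) \<in> real_disc_algebra"
        by (intro real_disc_algebra_intros f g g0)
      show "f z = 1 + (f z - 1) * inverse (g z) * g z" if "z \<in> cball 0 1" for z
        using g0[OF that] by (simp add: mult.assoc)
    qed (simp_all add: real_disc_algebra_1)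
  next
    case 2
    then have "f z \<noteq> 0" if "z \<in> cball 0 1" for z using that fg0[of z] unfolding Z_def by blast
    then show ?thesis by (rule congruent_to_unit_unit[OF f])
  next
    case 3
    then obtain w where w: "w \<in> cball 0 1" "g w \<noteq> 0" unfolding Z_def by blast
    have cont: "continuous_on (cball 0 1) f" "continuous_on (cball 0 1) g"
      using real_disc_algebraD(1)[OF f] real_disc_algebraD(1)[OF g] by (auto simp: disc_algebra_def)
    have "closed Z" unfolding Z_def by (intro continuous_closed_preimage_constant cont) auto
    moreover have "Z \<subseteq> cball 0 1" by (auto simp: Z_def)
    ultimately have "compact Z"
      by (meson bounded_cball bounded_subset compact_eq_bounded_closed)
    then obtain v where v: "v \<in> Z" "\<And>z. z \<in> Z \<Longrightarrow> norm (f v) \<le> norm (f z)"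
      using continuous_attains_inf[of Z "\<lambda>z. norm (f z)"] 3(1) \<open>Z \<subseteq> cball 0 1\<close>
      by (auto intro!: continuous_intros continuous_on_subset[OF cont(1)])
    have v0: "norm (f v) > 0" using v(1) fg0[of v] by (auto simp: Z_def)
    obtain e where e: "e > 0" "\<And>h. h \<in> real_disc_algebra \<Longrightarrow>
      \<forall>z\<in>cball 0 1. norm (h z - f z) \<le> e \<Longrightarrow> congruent_to_unit g h \<longleftrightarrow> congruent_to_unit g f"
      using congruent_to_unit_locally_constant[OF fg] by blast
    obtain p where p: "map_poly cnj p = p"
      "\<And>z. z \<in> cball 0 1 \<Longrightarrow> norm (poly p z - f z) < min e (norm (f v))"
      using real_disc_algebra_polynomial_approx[OF f, of "min e (norm (f v))"] e(1) v0 by auto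
    have near: "norm (poly p z - f z) < norm (f z)" if "z \<in> Z" for z
      using p(2)[of z] v(2)[OF that] that by (auto simp: Z_def)
    have "congruent_to_unit g (poly p)"
    proof (rule congruent_to_unit_poly[OF g w _ p(1)])
      show "poly p z \<noteq> 0" if "z \<in> cball 0 1" "g z = 0" for z
        using near[of z] that by (auto simp: Z_def)
      then show "p \<noteq> 0" using 3(1) by (force simp: Z_def)
      fix x :: real assume x: "x \<in> {-1..1}" "g (of_real x) = 0"
      have xc: "complex_of_real x \<in> cball 0 1" using x by auto
      have "f (of_real x) = of_real (Re (f (of_real x)))"
        using real_disc_algebra_real_on_interval[OF f x(1)] by (metis Re_complex_of_real)
      then have "norm (f (of_real x)) = Re (f (of_real x))"
        using pos[OF x] by (metis abs_of_pos norm_of_real)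
      moreover have "norm (poly p (of_real x) - f (of_real x)) < norm (f (of_real x))"
        using near[of "of_real x"] xc x by (simp add: Z_def)
      ultimately show "Re (poly p (of_real x)) > 0"
        using abs_Re_le_cmod[of "poly p (of_real x) - f (of_real x)"] by simp
    qed
    moreover have "congruent_to_unit g (poly p) \<longleftrightarrow> congruent_to_unit g f"
      using p(2) by (intro e(2) real_disc_algebra_poly p(1)) (force intro: less_imp_le)
    ultimately show ?thesis by simp
  qed
qed

section \<open>Simultaneous stabilization\<close>

lemma singular_points_iff:
  "x \<in> singular_points (f1, g1) (f2, g2) \<longleftrightarrow>
     x \<in> {-1..1} \<and> f1 (of_real x) * g2 (of_real x) - g1 (of_real x) * f2 (of_real x) = 0"
  by (simp add: singular_points_def invertible_det_nz pair_matrix_def det_2)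

lemma pair_ratio_eq:
  assumes "(f1, g1) \<in> invertible_pairs" "(f2, g2) \<in> invertible_pairs"
    and "x \<in> singular_points (f1, g1) (f2, g2)"
  shows "f2 (of_real x) = of_real (pair_ratio (f1, g1) (f2, g2) x) * f1 (of_real x)"
    and "g2 (of_real x) = of_real (pair_ratio (f1, g1) (f2, g2) x) * g1 (of_real x)"
proof -
  have "f2 (of_real x) = of_real (pair_ratio (f1, g1) (f2, g2) x) * f1 (of_real x) \<and>
        g2 (of_real x) = of_real (pair_ratio (f1, g1) (f2, g2) x) * g1 (of_real x)"
    using theI'[OF pair_ratio_ex1[OF assms]] unfolding pair_ratio_def by simp
  then show "f2 (of_real x) = of_real (pair_ratio (f1, g1) (f2, g2) x) * f1 (of_real x)"
    and "g2 (of_real x) = of_real (pair_ratio (f1, g1) (f2, g2) x) * g1 (of_real x)"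
    by blast+
qed

lemma simultaneously_stabilizable_imp_sign_linked:
  assumes pq: "(f1, g1) \<in> invertible_pairs" "(f2, g2) \<in> invertible_pairs"
    and u: "(\<lambda>z. \<alpha> z * f1 z + \<beta> z * g1 z) \<in> real_disc_algebra_units"
    and v: "(\<lambda>z. \<alpha> z * f2 z + \<beta> z * g2 z) \<in> real_disc_algebra_units"
  shows "sign_linked (f1, g1) (f2, g2)"
proof -
  define u where "u = (\<lambda>z. \<alpha> z * f1 z + \<beta> z * g1 z)"
  define v where "v = (\<lambda>z. \<alpha> z * f2 z + \<beta> z * g2 z)"
  \<comment> \<open>The sign of \<open>w\<close> on \<open>[-1,1]\<close> is constant, and it is the sign of \<open>v / u\<close>.\<close>
  define w where "w = (\<lambda>z. u z * v z)"
  have uv: "u \<in> real_disc_algebra" "v \<in> real_disc_algebra"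
    and uv0: "\<And>z. z \<in> cball 0 1 \<Longrightarrow> u z \<noteq> 0" "\<And>z. z \<in> cball 0 1 \<Longrightarrow> v z \<noteq> 0"
    using u v unfolding u_def v_def real_disc_algebra_units_iff by blast+
  have w: "w \<in> real_disc_algebra" unfolding w_def by (intro real_disc_algebra_mult uv)
  have w0: "Re (w (of_real x)) \<noteq> 0" if x: "x \<in> {-1..1}" for x
  proof -
    have "complex_of_real x \<in> cball 0 1" using x by auto
    then have "w (of_real x) \<noteq> 0" using uv0 by (simp add: w_def)
    moreover obtain r where "w (of_real x) = of_real r"
      using real_disc_algebra_real_on_interval[OF w x] .
    ultimately show ?thesis by auto
  qed
  have "continuous_on {-1..1} (\<lambda>x. w (of_real x))"
    by (rule disc_algebra_continuous_on_interval[OF real_disc_algebraD(1)[OF w]])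
  then have "connected ((\<lambda>x. Re (w (of_real x))) ` {-1..1})"
    by (intro connected_continuous_image continuous_on_Re) auto
  then have interval: "is_interval ((\<lambda>x. Re (w (of_real x))) ` {-1..1})"
    by (simp add: is_interval_connected_1)
  have sign: "Re (w (of_real x)) > 0"
    if "x \<in> {-1..1}" "y \<in> {-1..1}" "Re (w (of_real y)) > 0" for x y
  proof (rule ccontr)
    assume "\<not> Re (w (of_real x)) > 0"
    then have le: "Re (w (of_real x)) \<le> 0" "0 \<le> Re (w (of_real y))" using that(3) by simp_all
    have "0 \<in> (\<lambda>x. Re (w (of_real x))) ` {-1..1}"
      by (rule mem_is_interval_1_I[OF interval imageI[OF that(1)] imageI[OF that(2)] le])
    then obtain z where "z \<in> {-1..1}" "Re (w (of_real z)) = 0" by auto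
    then show False using w0 by blast
  qed
  have ratio: "pair_ratio (f1, g1) (f2, g2) x > 0 \<longleftrightarrow> Re (w (of_real x)) > 0"
    if x: "x \<in> singular_points (f1, g1) (f2, g2)" for x
  proof -
    have xI: "x \<in> {-1..1}" using x by (simp add: singular_points_iff)
    define l where "l = pair_ratio (f1, g1) (f2, g2) x"
    obtain r where r: "u (of_real x) = of_real r"
      using real_disc_algebra_real_on_interval[OF uv(1) xI] .
    have "v (of_real x) = of_real l * u (of_real x)"
      unfolding v_def u_def pair_ratio_eq[OF pq x] l_def by (simp add: algebra_simps)
    then have "Re (w (of_real x)) = l * r\<^sup>2"
      by (simp add: w_def r power2_eq_square)
    moreover have "r \<noteq> 0" using calculation w0[OF xI] by auto
    ultimately show ?thesis by (simp add: l_def zero_less_mult_iff)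
  qed
  show ?thesis
  proof (cases "\<exists>y\<in>{-1..1}. Re (w (of_real y)) > 0")
    case True
    then have "\<forall>x\<in>singular_points (f1, g1) (f2, g2). pair_ratio (f1, g1) (f2, g2) x > 0"
      using sign ratio singular_points_iff by blast
    then show ?thesis unfolding sign_linked_def by blast
  next
    case False
    then have "\<forall>x\<in>singular_points (f1, g1) (f2, g2). pair_ratio (f1, g1) (f2, g2) x < 0"
      using ratio pair_ratio_nonzero[OF pq] singular_points_iff by (meson linorder_neqE_linordered_idom)
    then show ?thesis unfolding sign_linked_def by blast
  qed
qed

lemma sign_linked_imp_simultaneously_stabilizable:
  assumes pq: "(f1, g1) \<in> invertible_pairs" "(f2, g2) \<in> invertible_pairs"
    and linked: "sign_linked (f1, g1) (f2, g2)"
  shows "\<exists>\<alpha>\<in>real_disc_algebra. \<exists>\<beta>\<in>real_disc_algebra.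
            (\<lambda>z. \<alpha> z * f1 z + \<beta> z * g1 z) \<in> real_disc_algebra_units \<and>
            (\<lambda>z. \<alpha> z * f2 z + \<beta> z * g2 z) \<in> real_disc_algebra_units"
proof -
  obtain a1 b1 where A: "f1 \<in> real_disc_algebra" "g1 \<in> real_disc_algebra"
      "a1 \<in> real_disc_algebra" "b1 \<in> real_disc_algebra"
    and e1: "\<And>z. z \<in> cball 0 1 \<Longrightarrow> a1 z * f1 z + b1 z * g1 z = 1"
    using pq(1) unfolding invertible_pairs_def by blast
  obtain a2 b2 where B: "f2 \<in> real_disc_algebra" "g2 \<in> real_disc_algebra"
      "a2 \<in> real_disc_algebra" "b2 \<in> real_disc_algebra"
    and e2: "\<And>z. z \<in> cball 0 1 \<Longrightarrow> a2 z * f2 z + b2 z * g2 z = 1"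
    using pq(2) unfolding invertible_pairs_def by blast
  define f where "f = (\<lambda>z. a1 z * f2 z + b1 z * g2 z)"
  define g where "g = (\<lambda>z. f1 z * g2 z - g1 z * f2 z)"
  have fg: "f \<in> real_disc_algebra" "g \<in> real_disc_algebra"
    unfolding f_def g_def by (intro real_disc_algebra_intros A B)+
  \<comment> \<open>Inverting the change of basis expresses the second pair through \<open>f\<close> and \<open>g\<close>, which turns its
    Bezout identity into one for \<open>(f, g)\<close>.\<close>
  have f2: "f2 z = f z * f1 z - b1 z * g z" and g2: "g2 z = f z * g1 z + a1 z * g z"
    if z: "z \<in> cball 0 1" for z
  proof -
    have "f z * f1 z - b1 z * g z = (a1 z * f1 z + b1 z * g1 z) * f2 z"
      "f z * g1 z + a1 z * g z = (a1 z * f1 z + b1 z * g1 z) * g2 z"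
      by (simp_all add: f_def g_def algebra_simps)
    then show "f2 z = f z * f1 z - b1 z * g z" "g2 z = f z * g1 z + a1 z * g z"
      using e1[OF z] by simp_all
  qed
  have comax: "(a2 z * f1 z + b2 z * g1 z) * f z + (b2 z * a1 z - a2 z * b1 z) * g z = 1"
    if z: "z \<in> cball 0 1" for z
  proof -
    have "(a2 z * f1 z + b2 z * g1 z) * f z + (b2 z * a1 z - a2 z * b1 z) * g z
        = a2 z * (f z * f1 z - b1 z * g z) + b2 z * (f z * g1 z + a1 z * g z)"
      by (simp add: algebra_simps)
    also have "\<dots> = 1" using e2[OF z] f2[OF z] g2[OF z] by simp
    finally show ?thesis .
  qed
  have cd: "(\<lambda>z. a2 z * f1 z + b2 z * g1 z) \<in> real_disc_algebra"
    "(\<lambda>z. b2 z * a1 z - a2 z * b1 z) \<in> real_disc_algebra"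
    by (intro real_disc_algebra_intros A B)+
  have pair: "(f, g) \<in> invertible_pairs"
    by (rule invertible_pairsI[OF fg cd comax])
  have ratio: "f (of_real x) = of_real (pair_ratio (f1, g1) (f2, g2) x)"
    "x \<in> singular_points (f1, g1) (f2, g2)"
    if x: "x \<in> {-1..1}" "g (of_real x) = 0" for x
  proof -
    show S: "x \<in> singular_points (f1, g1) (f2, g2)"
      using x by (simp add: singular_points_iff g_def)
    have "complex_of_real x \<in> cball 0 1" using x by auto
    then have "a1 (of_real x) * f1 (of_real x) + b1 (of_real x) * g1 (of_real x) = 1" by (rule e1)
    moreover have "f (of_real x) = of_real (pair_ratio (f1, g1) (f2, g2) x) *
        (a1 (of_real x) * f1 (of_real x) + b1 (of_real x) * g1 (of_real x))"
      unfolding f_def pair_ratio_eq[OF pq S] by (simp add: algebra_simps)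
    ultimately show "f (of_real x) = of_real (pair_ratio (f1, g1) (f2, g2) x)" by simp
  qed
  have "congruent_to_unit g f"
    using linked unfolding sign_linked_def
  proof
    assume "\<forall>x\<in>singular_points (f1, g1) (f2, g2). pair_ratio (f1, g1) (f2, g2) x > 0"
    then show ?thesis
      using ratio by (intro congruent_to_unit_if_positive[OF pair]) auto
  next
    assume neg: "\<forall>x\<in>singular_points (f1, g1) (f2, g2). pair_ratio (f1, g1) (f2, g2) x < 0"
    have c: "(\<lambda>z. - (a2 z * f1 z + b2 z * g1 z)) \<in> real_disc_algebra"
      by (rule real_disc_algebra_uminus[OF cd(1)])
    have "- (a2 z * f1 z + b2 z * g1 z) * (- f z) + (b2 z * a1 z - a2 z * b1 z) * g z = 1"
      if "z \<in> cball 0 1" for z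
      unfolding minus_mult_minus by (rule comax[OF that])
    then have "(\<lambda>z. - f z, g) \<in> invertible_pairs"
      by (rule invertible_pairsI[OF real_disc_algebra_uminus[OF fg(1)] fg(2) c cd(2)])
    then have "congruent_to_unit g (\<lambda>z. - f z)"
      using ratio neg by (intro congruent_to_unit_if_positive) auto
    then show ?thesis
      by (rule congruent_to_unit_transfer[of _ _ "\<lambda>z. -1" "\<lambda>z. 0"])
         (auto intro!: real_disc_algebra_uminus real_disc_algebra_intros)
  qed
  then obtain u k where u: "u \<in> real_disc_algebra" "\<And>z. z \<in> cball 0 1 \<Longrightarrow> u z \<noteq> 0"
    "k \<in> real_disc_algebra" "\<And>z. z \<in> cball 0 1 \<Longrightarrow> f z = u z + k z * g z"
    by (rule congruent_to_unitE) (rule that)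
  \<comment> \<open>In the new basis the coefficients \<open>(1, -k)\<close> send \<open>(1, 0)\<close> to 1 and \<open>(f, g)\<close> to \<open>u\<close>; \<open>(\<alpha>, \<beta>)\<close> is the
    image of \<open>(1, -k)\<close> under the matrix of the change of basis.\<close>
  define \<alpha> where "\<alpha> = (\<lambda>z. a1 z + k z * g1 z)"
  define \<beta> where "\<beta> = (\<lambda>z. b1 z - k z * f1 z)"
  have ab: "\<alpha> \<in> real_disc_algebra" "\<beta> \<in> real_disc_algebra"
    unfolding \<alpha>_def \<beta>_def by (intro real_disc_algebra_intros A u)+
  have v1: "\<alpha> z * f1 z + \<beta> z * g1 z = 1" if z: "z \<in> cball 0 1" for z
    using e1[OF z] by (simp add: \<alpha>_def \<beta>_def algebra_simps)
  have v2: "\<alpha> z * f2 z + \<beta> z * g2 z = u z" if z: "z \<in> cball 0 1" for z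
  proof -
    have "\<alpha> z * f2 z + \<beta> z * g2 z = f z - k z * g z"
      by (simp add: \<alpha>_def \<beta>_def f_def g_def algebra_simps)
    then show ?thesis using u(4)[OF z] by simp
  qed
  have "(\<lambda>z. \<alpha> z * f1 z + \<beta> z * g1 z) \<in> real_disc_algebra_units"
    "(\<lambda>z. \<alpha> z * f2 z + \<beta> z * g2 z) \<in> real_disc_algebra_units"
    unfolding real_disc_algebra_units_iff
    using v1 v2 u(2) by (auto intro!: real_disc_algebra_add real_disc_algebra_mult ab A B)
  then show ?thesis using ab by blast
qed

theorem theorem0p2:
  fixes f1 g1 f2 g2 :: "complex \<Rightarrow> complex"
  assumes "(f1, g1) \<in> invertible_pairs" and "(f2, g2) \<in> invertible_pairs"
  shows "(\<exists>\<alpha>\<in>real_disc_algebra. \<exists>\<beta>\<in>real_disc_algebra.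
            (\<lambda>z. \<alpha> z * f1 z + \<beta> z * g1 z) \<in> real_disc_algebra_units \<and>
            (\<lambda>z. \<alpha> z * f2 z + \<beta> z * g2 z) \<in> real_disc_algebra_units)
         \<longleftrightarrow> sign_linked (f1, g1) (f2, g2)"
  using simultaneously_stabilizable_imp_sign_linked[OF assms]
    sign_linked_imp_simultaneously_stabilizable[OF assms] by blast

end
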